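(* Let $A$ be a commutative Banach algebra with $\Delta(A)\neq\emptyset$ and let $\alpha>0$. Let $\mathfrak{F}(X,A)$ be one of the Banach algebras $C_b(X,A)$, $C_0(X,A)$ (in which cases $X$ is a locally compact Hausdorff space), $\mathrm{Lip}_\alpha(X,A)$ or $\mathrm{lip}_\alpha(X,A)$ (in which cases $X$ is a metric space). If $\mathfrak{F}(X,A)$ is biprojective, then $X$ and $\Delta(A)$ are discrete.
   Context: $\Delta(A)$ is the character space of $A$ (non-zero multiplicative linear functionals) with the weak$^*$ (Gelfand) topology. $C_b(X,A)$ (resp. $C_0(X,A)$) is the Banach algebra of bounded continuous functions (resp. continuous functions vanishing at infinity) from $X$ into $A$, with pointwise operations and the norm $\|f\|_\infty=\sup_{x\in X}\|f(x)\|$. For a metric space $(X,d)$ and $\alpha>0$, $\mathrm{Lip}_\alpha(X,A)$ is the Banach algebra (pointwise operations) of bounded functions $f:X\to A$ with $p_\alpha(f)=\sup_{x\neq y}\|f(x)-f(y)\|/d(x,y)^\alpha<\infty$, normed by $\|f\|_{\infty,\alpha}=\|f\|_\infty+p_\alpha(f)$, and $\mathrm{lip}_\alpha(X,A)$ is its subalgebra of those $f$ with $\|f(x)-f(y)\|/d(x,y)^\alpha\to 0$ as $d(x,y)\to 0$. A Banach algebra $B$ is biprojective if it is projective as a Banach $B$-bimodule; equivalently, the diagonal operator $\pi_B: B\hat{\otimes}B\to B$, $\pi_B(a\otimes b)=ab$, on the projective tensor product has a bounded $B$-bimodule right inverse.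
   Formalization: X is taken nonempty; discreteness of X is claimed for Lip_α only if α ≤ 1 or Lip_α(X,A) separates points, and for lip_α only if α < 1 or lip_α(X,A) separates points, since e.g. Lip_2(ℝ,ℂ) ≅ ℂ is biprojective but ℝ is not discrete. *)

theory Defs
  imports "HOL-Analysis.Analysis" "HOL-Library.Function_Algebras"
begin

section \<open>Complex algebras and complex Banach algebras\<close>

text \<open>The distribution has no normed algebras over the complex numbers. No unit is assumed.\<close>

class complex_algebra = ring +
  fixes scaleC :: "complex \<Rightarrow> 'a \<Rightarrow> 'a" (infixr \<open>*\<^sub>C\<close> 75)
  assumes scaleC_add_right: "c *\<^sub>C (x + y) = c *\<^sub>C x + c *\<^sub>C y"
    and scaleC_add_left: "(c + d) *\<^sub>C x = c *\<^sub>C x + d *\<^sub>C x"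
    and scaleC_scaleC: "c *\<^sub>C d *\<^sub>C x = (c * d) *\<^sub>C x"
    and scaleC_one: "1 *\<^sub>C x = x"
    and mult_scaleC_left: "(c *\<^sub>C x) * y = c *\<^sub>C (x * y)"
    and mult_scaleC_right: "x * (c *\<^sub>C y) = c *\<^sub>C (x * y)"

class complex_banach_algebra = complex_algebra + real_normed_algebra + banach +
  assumes scaleR_eq_scaleC: "r *\<^sub>R x = complex_of_real r *\<^sub>C x"
    and norm_scaleC: "norm (c *\<^sub>C x) = cmod c * norm x"

instantiation complex :: complex_banach_algebra
begin
definition scaleC_complex :: "complex \<Rightarrow> complex \<Rightarrow> complex" where
  "scaleC_complex c z = c * z"
instance
  by standard (simp_all add: scaleC_complex_def algebra_simps norm_mult scaleR_conv_of_real)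
end

instantiation "fun" :: (type, complex_algebra) complex_algebra
begin
definition scaleC_fun :: "complex \<Rightarrow> ('a \<Rightarrow> 'b) \<Rightarrow> 'a \<Rightarrow> 'b" where
  "scaleC_fun c f = (\<lambda>x. c *\<^sub>C f x)"
instance
  by standard (simp_all add: scaleC_fun_def fun_eq_iff scaleC_add_right scaleC_add_left
      scaleC_scaleC scaleC_one mult_scaleC_left mult_scaleC_right)
end

text \<open>
  The function type carries the product topology, so as a subspace of \<^typ>\<open>'a \<Rightarrow> complex\<close> the
  set of characters has the topology of pointwise convergence, i.e. the Gelfand topology.
\<close>

definition characters :: "('a::complex_banach_algebra \<Rightarrow> complex) set" where
  "characters = {\<phi>. (\<forall>a b. \<phi> (a + b) = \<phi> a + \<phi> b) \<and> (\<forall>c a. \<phi> (c *\<^sub>C a) = c * \<phi> a) \<and>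
                    (\<forall>a b. \<phi> (a * b) = \<phi> a * \<phi> b) \<and> (\<exists>a. \<phi> a \<noteq> 0)}"


section \<open>The projective tensor product and biprojectivity\<close>

text \<open>
  A Banach algebra is given by a subalgebra \<open>B\<close> of an ambient complex algebra together with a
  norm \<open>N\<close> on \<open>B\<close>. Forms, tensors and maps are only relevant on \<open>B\<close>.
\<close>

definition bounded_bilinear_forms ::
    "'b::complex_algebra set \<Rightarrow> ('b \<Rightarrow> real) \<Rightarrow> ('b \<Rightarrow> 'b \<Rightarrow> complex) set" where
  "bounded_bilinear_forms B N = {\<beta>.
     (\<forall>a\<in>B. \<forall>a'\<in>B. \<forall>b\<in>B. \<beta> (a + a') b = \<beta> a b + \<beta> a' b) \<and>
     (\<forall>a\<in>B. \<forall>b\<in>B. \<forall>b'\<in>B. \<beta> a (b + b') = \<beta> a b + \<beta> a b') \<and>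
     (\<forall>c. \<forall>a\<in>B. \<forall>b\<in>B. \<beta> (c *\<^sub>C a) b = c * \<beta> a b \<and> \<beta> a (c *\<^sub>C b) = c * \<beta> a b) \<and>
     (\<exists>K. \<forall>a\<in>B. \<forall>b\<in>B. cmod (\<beta> a b) \<le> K * N a * N b)}"

text \<open>
  Every element of the completed projective tensor product of \<open>B\<close> with itself is the sum of a
  series of elementary tensors \<open>a n \<otimes> b n\<close> with \<open>\<Sum>n. N (a n) * N (b n)\<close> finite, and its
  projective norm is the infimum of these sums (Grothendieck). The dual of the tensor product is
  the space of bounded bilinear forms, so two such series have the same sum iff they agree on
  every bounded bilinear form. The sum of a series is therefore represented by the functional
  \<open>\<beta> \<mapsto> \<Sum>n. \<beta> (a n) (b n)\<close> on bounded bilinear forms.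
\<close>

type_synonym 'b tensor = "('b \<Rightarrow> 'b \<Rightarrow> complex) \<Rightarrow> complex"

definition tensor_sums ::
    "'b::complex_algebra set \<Rightarrow> ('b \<Rightarrow> real) \<Rightarrow> (nat \<Rightarrow> 'b) \<Rightarrow> (nat \<Rightarrow> 'b) \<Rightarrow> 'b tensor \<Rightarrow> bool" where
  "tensor_sums B N a b u \<longleftrightarrow>
     range a \<subseteq> B \<and> range b \<subseteq> B \<and> summable (\<lambda>n. N (a n) * N (b n)) \<and>
     u = (\<lambda>\<beta>\<in>bounded_bilinear_forms B N. \<Sum>n. \<beta> (a n) (b n))"

definition proj_tensor :: "'b::complex_algebra set \<Rightarrow> ('b \<Rightarrow> real) \<Rightarrow> 'b tensor set" where
  "proj_tensor B N = {u. \<exists>a b. tensor_sums B N a b u}"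

definition proj_norm :: "'b::complex_algebra set \<Rightarrow> ('b \<Rightarrow> real) \<Rightarrow> 'b tensor \<Rightarrow> real" where
  "proj_norm B N u = Inf {(\<Sum>n. N (a n) * N (b n)) | a b. tensor_sums B N a b u}"

definition tensor_add ::
    "'b::complex_algebra set \<Rightarrow> ('b \<Rightarrow> real) \<Rightarrow> 'b tensor \<Rightarrow> 'b tensor \<Rightarrow> 'b tensor" where
  "tensor_add B N u v = (\<lambda>\<beta>\<in>bounded_bilinear_forms B N. u \<beta> + v \<beta>)"

definition tensor_scale ::
    "'b::complex_algebra set \<Rightarrow> ('b \<Rightarrow> real) \<Rightarrow> complex \<Rightarrow> 'b tensor \<Rightarrow> 'b tensor" where
  "tensor_scale B N c u = (\<lambda>\<beta>\<in>bounded_bilinear_forms B N. c * u \<beta>)"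

text \<open>
  The bimodule operations are those determined by \<open>c \<cdot> (a \<otimes> b) = (c * a) \<otimes> b\<close> and
  \<open>(a \<otimes> b) \<cdot> c = a \<otimes> (b * c)\<close>.
\<close>

definition tensor_left ::
    "'b::complex_algebra set \<Rightarrow> ('b \<Rightarrow> real) \<Rightarrow> 'b \<Rightarrow> 'b tensor \<Rightarrow> 'b tensor" where
  "tensor_left B N c u = (\<lambda>\<beta>\<in>bounded_bilinear_forms B N. u (\<lambda>a b. \<beta> (c * a) b))"

definition tensor_right ::
    "'b::complex_algebra set \<Rightarrow> ('b \<Rightarrow> real) \<Rightarrow> 'b tensor \<Rightarrow> 'b \<Rightarrow> 'b tensor" where
  "tensor_right B N u c = (\<lambda>\<beta>\<in>bounded_bilinear_forms B N. u (\<lambda>a b. \<beta> a (b * c)))"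

text \<open>
  The graph of the diagonal operator \<open>\<pi>\<close>: if \<open>u\<close> is the sum of the tensors \<open>a n \<otimes> b n\<close>, then
  \<open>\<pi> u\<close> is the sum in \<open>B\<close> of the products \<open>a n * b n\<close>. When \<open>B\<close> is a Banach algebra this
  does not depend on the series, since bounded functionals on \<open>B\<close> separate points.
\<close>

definition diagonal_op ::
    "'b::complex_algebra set \<Rightarrow> ('b \<Rightarrow> real) \<Rightarrow> 'b tensor \<Rightarrow> 'b \<Rightarrow> bool" where
  "diagonal_op B N u f \<longleftrightarrow> f \<in> B \<and>
     (\<exists>a b. tensor_sums B N a b u \<and> (\<lambda>n. N ((\<Sum>k<n. a k * b k) - f)) \<longlonglongrightarrow> 0)"

definition biprojective :: "'b::complex_algebra set \<Rightarrow> ('b \<Rightarrow> real) \<Rightarrow> bool" where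
  "biprojective B N \<longleftrightarrow> (\<exists>\<rho>.
     (\<forall>f\<in>B. \<rho> f \<in> proj_tensor B N) \<and>
     (\<forall>f\<in>B. \<forall>g\<in>B. \<rho> (f + g) = tensor_add B N (\<rho> f) (\<rho> g)) \<and>
     (\<forall>c. \<forall>f\<in>B. \<rho> (c *\<^sub>C f) = tensor_scale B N c (\<rho> f)) \<and>
     (\<exists>K. \<forall>f\<in>B. proj_norm B N (\<rho> f) \<le> K * N f) \<and>
     (\<forall>f\<in>B. \<forall>g\<in>B. \<rho> (f * g) = tensor_left B N f (\<rho> g) \<and> \<rho> (f * g) = tensor_right B N (\<rho> f) g) \<and>
     (\<forall>f\<in>B. diagonal_op B N (\<rho> f) f))"


section \<open>Algebras of vector-valued functions\<close>

definition sup_norm :: "('x \<Rightarrow> 'a::complex_banach_algebra) \<Rightarrow> real" where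
  "sup_norm f = (SUP x. norm (f x))"

definition Cb :: "('x::topological_space \<Rightarrow> 'a::complex_banach_algebra) set" where
  "Cb = {f. continuous_on UNIV f \<and> bounded (range f)}"

definition C0 :: "('x::topological_space \<Rightarrow> 'a::complex_banach_algebra) set" where
  "C0 = {f. continuous_on UNIV f \<and> (\<forall>\<epsilon>>0. \<exists>K. compact K \<and> (\<forall>x. x \<notin> K \<longrightarrow> norm (f x) < \<epsilon>))}"

text \<open>
  For \<open>x = y\<close> the quotient is \<open>0 / 0 = 0\<close>, so a supremum over all pairs of points equals the one
  over distinct points (and is \<open>0\<close> on a one-point space).
\<close>

definition lip_quot ::
    "real \<Rightarrow> ('x::metric_space \<Rightarrow> 'a::complex_banach_algebra) \<Rightarrow> 'x \<times> 'x \<Rightarrow> real" where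
  "lip_quot \<alpha> f = (\<lambda>(x, y). norm (f x - f y) / dist x y powr \<alpha>)"

definition lip_norm :: "real \<Rightarrow> ('x::metric_space \<Rightarrow> 'a::complex_banach_algebra) \<Rightarrow> real" where
  "lip_norm \<alpha> f = sup_norm f + (SUP p. lip_quot \<alpha> f p)"

definition Lip :: "real \<Rightarrow> ('x::metric_space \<Rightarrow> 'a::complex_banach_algebra) set" where
  "Lip \<alpha> = {f. bounded (range f) \<and> bdd_above (range (lip_quot \<alpha> f))}"

definition little_lip :: "real \<Rightarrow> ('x::metric_space \<Rightarrow> 'a::complex_banach_algebra) set" where
  "little_lip \<alpha> = {f \<in> Lip \<alpha>. \<forall>\<epsilon>>0. \<exists>\<delta>>0. \<forall>x y. dist x y < \<delta> \<longrightarrow> lip_quot \<alpha> f (x, y) < \<epsilon>}"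

text \<open>
  On a connected metric space such as the real line, \<^term>\<open>Lip \<alpha>\<close> for \<open>\<alpha> > 1\<close> and
  \<^term>\<open>little_lip \<alpha>\<close> for \<open>\<alpha> \<ge> 1\<close> may consist of constant functions only. Such an algebra is a
  copy of \<open>A\<close>, which may be biprojective, and carries no information on the topology of \<open>X\<close>.
  Outside the classical ranges (\<open>\<alpha> \<le> 1\<close> and \<open>\<alpha> < 1\<close>, where separation is automatic) discreteness of
  \<open>X\<close> is therefore claimed only if the algebra separates the points of \<open>X\<close>.
\<close>

definition separates_points :: "('x \<Rightarrow> 'a) set \<Rightarrow> bool" where
  "separates_points F \<longleftrightarrow> (\<forall>x y. x \<noteq> y \<longrightarrow> (\<exists>f\<in>F. f x \<noteq> f y))"

end

theory Submission
  imports Defs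
begin

text \<open>
  A biprojective Banach algebra \<open>B\<close> has isolated characters. Let \<open>\<rho>\<close> be a bounded bimodule right
  inverse of the diagonal operator \<open>\<pi>\<close>, and let \<open>\<phi>\<close>, \<open>\<psi>\<close> be characters of \<open>B\<close>. The functional
  \<open>T = (\<phi> \<otimes> \<psi>) \<circ> \<rho>\<close> satisfies \<open>T (f * g) = \<phi> f * T g = T f * \<psi> g\<close>, because \<open>\<rho>\<close> respects both
  module actions. Hence \<open>T\<close> is a multiple of \<open>\<phi>\<close> and a multiple of \<open>\<psi>\<close>, so \<open>T = 0\<close> when
  \<open>\<phi> \<noteq> \<psi>\<close>; and when \<open>\<phi> = \<psi>\<close>, multiplicativity gives \<open>T = \<phi> \<circ> \<pi> \<circ> \<rho> = \<phi>\<close>. Now fix \<open>\<phi>\<close> and \<open>f\<close>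
  with \<open>\<phi> f \<noteq> 0\<close>, and write \<open>\<rho> f\<close> as a series of elementary tensors \<open>a n \<otimes> b n\<close>. The function
  \<open>\<psi> \<mapsto> \<Sum>n. \<phi> (a n) * \<psi> (b n)\<close> is a uniformly convergent series of Gelfand transforms, hence
  continuous; it is nonzero at \<open>\<phi>\<close> and vanishes at every other character. So \<open>\<phi>\<close> is isolated
  (\<open>biprojective_separating_series\<close>, \<open>biprojective_imp_discrete\<close>).

  In an algebra of functions from \<open>X\<close> to \<open>A\<close>, each point \<open>x\<close> of \<open>X\<close> and each character \<open>\<phi>\<close> of
  \<open>A\<close> give the character \<open>f \<mapsto> \<phi> (f x)\<close>. Fixing \<open>x\<close> embeds the characters of \<open>A\<close>
  continuously, and fixing \<open>\<phi>\<close> embeds \<open>X\<close> continuously, provided that the algebra contains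
  enough functions of the form \<open>z \<mapsto> h z *\<^sub>R a\<close> with \<open>h\<close> a real function. A continuous injection
  into a discrete set forces its domain to be discrete (\<open>function_algebra_discrete_characters\<close>,
  \<open>function_algebra_discrete_points\<close>). The real functions come from complete regularity of
  locally compact Hausdorff spaces, from the truncated distance \<open>z \<mapsto> min 1 (dist x z)\<close>, or, when
  the algebra is only known to separate points, from \<open>z \<mapsto> norm (f z - f x)\<close>.
\<close>

section \<open>Characters of Banach algebras\<close>

text \<open>
  Without a unit, the usual argument inverting \<open>1 - b\<close> is replaced by solving \<open>s = b + b * s\<close>.
\<close>
lemma character_norm_le:
  fixes \<phi> :: "'a::complex_banach_algebra \<Rightarrow> complex"
  assumes "\<phi> \<in> characters"
  shows "cmod (\<phi> a) \<le> norm a"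
proof (rule ccontr)
  assume "\<not> cmod (\<phi> a) \<le> norm a"
  then have less: "norm a < cmod (\<phi> a)" by simp
  then have nz: "\<phi> a \<noteq> 0" by auto
  have add: "\<phi> (x + y) = \<phi> x + \<phi> y" and scale: "\<phi> (c *\<^sub>C x) = c * \<phi> x"
    and mult: "\<phi> (x * y) = \<phi> x * \<phi> y" for x y c
    using assms by (auto simp: characters_def)
  define b where "b = inverse (\<phi> a) *\<^sub>C a"
  have phi_b: "\<phi> b = 1" using nz by (simp add: b_def scale)
  have norm_b: "norm b < 1"
    using less nz by (simp add: b_def norm_scaleC norm_inverse norm_divide field_simps)
  have "dist (b + b * x) (b + b * y) \<le> norm b * dist x y" for x y
    using norm_mult_ineq[of b "x - y"] by (simp add: dist_norm right_diff_distrib)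
  then obtain s where "b + b * s = s"
    using banach_fix_type[of "norm b" "\<lambda>x. b + b * x"] norm_b by auto
  then have "\<phi> s = \<phi> b + \<phi> b * \<phi> s" by (metis add mult)
  then show False by (simp add: phi_b)
qed

lemma character_scaleR:
  assumes "\<phi> \<in> characters"
  shows "\<phi> (r *\<^sub>R a) = complex_of_real r * \<phi> a"
  using assms by (simp add: characters_def scaleR_eq_scaleC)

text \<open>
  The norm bound is required only on \<open>B\<close>, whereas linearity and multiplicativity are required on
  the whole ambient algebra, as holds for point evaluations. This keeps algebraic computations
  free of membership conditions.
\<close>
definition contractive_characters ::
    "'b::complex_algebra set \<Rightarrow> ('b \<Rightarrow> real) \<Rightarrow> ('b \<Rightarrow> complex) set" where
  "contractive_characters B N = {\<eta>. (\<forall>f g. \<eta> (f + g) = \<eta> f + \<eta> g) \<and> (\<forall>c f. \<eta> (c *\<^sub>C f) = c * \<eta> f) \<and>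
     (\<forall>f g. \<eta> (f * g) = \<eta> f * \<eta> g) \<and> (\<forall>f\<in>B. cmod (\<eta> f) \<le> N f)}"

lemma contractive_charactersD:
  assumes "\<eta> \<in> contractive_characters B N"
  shows "\<eta> (f + g) = \<eta> f + \<eta> g" "\<eta> (c *\<^sub>C f) = c * \<eta> f" "\<eta> (f * g) = \<eta> f * \<eta> g"
    "f \<in> B \<Longrightarrow> cmod (\<eta> f) \<le> N f"
  using assms by (auto simp: contractive_characters_def)

lemma contractive_character_zero:
  assumes "\<eta> \<in> contractive_characters B N" shows "\<eta> 0 = 0"
  using contractive_charactersD(1)[OF assms, of 0 0] by simp

lemma contractive_character_diff:
  assumes "\<eta> \<in> contractive_characters B N" shows "\<eta> (f - g) = \<eta> f - \<eta> g"
  using contractive_charactersD(1)[OF assms, of "f - g" g] by simp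

lemma contractive_character_sum:
  assumes "\<eta> \<in> contractive_characters B N" shows "\<eta> (\<Sum>k<(n::nat). h k) = (\<Sum>k<n. \<eta> (h k))"
  by (induction n) (simp_all add: contractive_character_zero[OF assms] contractive_charactersD[OF assms])

section \<open>Isolated characters of biprojective algebras\<close>

lemma contractive_character_product_le:
  assumes "\<phi> \<in> contractive_characters B N" "\<psi> \<in> contractive_characters B N" "a \<in> B" "b \<in> B"
  shows "cmod (\<phi> a * \<psi> b) \<le> N a * N b"
proof -
  have "cmod (\<phi> a) \<le> N a" "cmod (\<psi> b) \<le> N b"
    using assms contractive_charactersD(4) by blast+
  then show ?thesis
    by (simp add: norm_mult mult_mono order_trans[OF norm_ge_zero])
qed

lemma scaled_character_product_bounded_bilinear:
  assumes "\<phi> \<in> contractive_characters B N" "\<psi> \<in> contractive_characters B N"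
  shows "(\<lambda>a b. c * (\<phi> a * \<psi> b)) \<in> bounded_bilinear_forms B N"
proof -
  have "cmod (c * (\<phi> a * \<psi> b)) \<le> cmod c * N a * N b" if "a \<in> B" "b \<in> B" for a b
    using contractive_character_product_le[OF assms that]
    by (metis mult.assoc mult_left_mono norm_ge_zero norm_mult)
  then show ?thesis
    unfolding bounded_bilinear_forms_def
    by (auto simp: contractive_charactersD[OF assms(1)] contractive_charactersD[OF assms(2)]
        algebra_simps intro!: exI[of _ "cmod c"])
qed

lemma character_product_bounded_bilinear:
  assumes "\<phi> \<in> contractive_characters B N" "\<psi> \<in> contractive_characters B N"
  shows "(\<lambda>a b. \<phi> a * \<psi> b) \<in> bounded_bilinear_forms B N"
  using scaled_character_product_bounded_bilinear[OF assms, of 1] by simp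

lemma character_product_summable:
  assumes "\<phi> \<in> contractive_characters B N" "\<psi> \<in> contractive_characters B N"
    and "tensor_sums B N a b u"
  shows "summable (\<lambda>n. \<phi> (a n) * \<psi> (b n))"
proof (rule summable_comparison_test')
  show "summable (\<lambda>n. N (a n) * N (b n))"
    using assms(3) by (simp add: tensor_sums_def)
  show "norm (\<phi> (a n) * \<psi> (b n)) \<le> N (a n) * N (b n)" for n
    using contractive_character_product_le[OF assms(1,2), of "a n" "b n"] assms(3)
    by (auto simp: tensor_sums_def)
qed

lemma tensor_scaled_character_product:
  assumes "\<phi> \<in> contractive_characters B N" "\<psi> \<in> contractive_characters B N"
    and "u \<in> proj_tensor B N"
  shows "u (\<lambda>a b. c * (\<phi> a * \<psi> b)) = c * u (\<lambda>a b. \<phi> a * \<psi> b)"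
proof -
  obtain a b where ts: "tensor_sums B N a b u"
    using assms(3) by (auto simp: proj_tensor_def)
  then have u: "u \<beta> = (\<Sum>n. \<beta> (a n) (b n))" if "\<beta> \<in> bounded_bilinear_forms B N" for \<beta>
    using that by (simp add: tensor_sums_def)
  show ?thesis
    by (simp add: u scaled_character_product_bounded_bilinear character_product_bounded_bilinear
        suminf_mult character_product_summable[OF assms(1,2) ts] assms(1,2))
qed

text \<open>
  The convergence in \<open>diagonal_op\<close> is measured by \<open>N\<close>, which dominates \<open>\<phi>\<close> only on \<open>B\<close>; closure of
  \<open>B\<close> under the ring operations keeps the partial sums inside \<open>B\<close>.
\<close>
lemma character_of_diagonal_op:
  assumes phi: "\<phi> \<in> contractive_characters B N"
    and closed: "\<And>f g. f \<in> B \<Longrightarrow> g \<in> B \<Longrightarrow> f + g \<in> B" "\<And>f g. f \<in> B \<Longrightarrow> g \<in> B \<Longrightarrow> f - g \<in> B"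
      "\<And>f g. f \<in> B \<Longrightarrow> g \<in> B \<Longrightarrow> f * g \<in> B"
    and diag: "diagonal_op B N u f"
  shows "u (\<lambda>a b. \<phi> a * \<phi> b) = \<phi> f"
proof -
  obtain a b where f: "f \<in> B" and ts: "tensor_sums B N a b u"
    and lim: "(\<lambda>n. N ((\<Sum>k<n. a k * b k) - f)) \<longlonglongrightarrow> 0"
    using diag by (auto simp: diagonal_op_def)
  have zero: "0 \<in> B" using closed(2)[OF f f] by simp
  have mem: "a n \<in> B" "b n \<in> B" for n using ts by (auto simp: tensor_sums_def)
  have partial: "(\<Sum>k<n. a k * b k) \<in> B" for n
    by (induction n) (auto simp: zero closed mem)
  have "(\<lambda>n. \<phi> ((\<Sum>k<n. a k * b k) - f)) \<longlonglongrightarrow> 0"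
    by (rule Lim_null_comparison[OF _ lim])
      (auto intro!: always_eventually contractive_charactersD(4)[OF phi] closed partial f)
  then have "(\<lambda>n. (\<Sum>k<n. \<phi> (a k) * \<phi> (b k)) - \<phi> f) \<longlonglongrightarrow> 0"
    by (simp add: contractive_character_diff[OF phi] contractive_character_sum[OF phi]
        contractive_charactersD(3)[OF phi])
  then have "(\<lambda>n. \<phi> (a n) * \<phi> (b n)) sums \<phi> f"
    by (simp add: sums_def LIM_zero_iff)
  then show ?thesis
    using ts character_product_bounded_bilinear[OF phi phi]
    by (simp add: tensor_sums_def sums_unique[symmetric])
qed

text \<open>
  The series is a representation of \<open>\<rho> f\<close>; its value at \<open>\<psi>\<close> is \<open>T f\<close> for \<open>T = (\<phi> \<otimes> \<psi>) \<circ> \<rho>\<close>.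
\<close>
lemma biprojective_separating_series:
  assumes bip: "biprojective B N"
    and closed: "\<And>f g. f \<in> B \<Longrightarrow> g \<in> B \<Longrightarrow> f + g \<in> B" "\<And>f g. f \<in> B \<Longrightarrow> g \<in> B \<Longrightarrow> f - g \<in> B"
      "\<And>f g. f \<in> B \<Longrightarrow> g \<in> B \<Longrightarrow> f * g \<in> B"
    and phi: "\<phi> \<in> contractive_characters B N" and f: "f \<in> B"
  obtains a b where "range a \<subseteq> B" "range b \<subseteq> B" "summable (\<lambda>n. N (a n) * N (b n))"
    "(\<Sum>n. \<phi> (a n) * \<phi> (b n)) = \<phi> f"
    "\<And>\<psi> h. \<psi> \<in> contractive_characters B N \<Longrightarrow> h \<in> B \<Longrightarrow> \<phi> h \<noteq> \<psi> h \<Longrightarrow> (\<Sum>n. \<phi> (a n) * \<psi> (b n)) = 0"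
proof -
  obtain \<rho> where tensor: "\<And>g. g \<in> B \<Longrightarrow> \<rho> g \<in> proj_tensor B N"
    and left: "\<And>g h. g \<in> B \<Longrightarrow> h \<in> B \<Longrightarrow> \<rho> (g * h) = tensor_left B N g (\<rho> h)"
    and right: "\<And>g h. g \<in> B \<Longrightarrow> h \<in> B \<Longrightarrow> \<rho> (g * h) = tensor_right B N (\<rho> g) h"
    and diag: "\<And>g. g \<in> B \<Longrightarrow> diagonal_op B N (\<rho> g) g"
    using bip unfolding biprojective_def by blast
  obtain a b where ts: "tensor_sums B N a b (\<rho> f)"
    using tensor[OF f] by (auto simp: proj_tensor_def)
  have series: "\<rho> f (\<lambda>a b. \<phi> a * \<psi> b) = (\<Sum>n. \<phi> (a n) * \<psi> (b n))"
    if "\<psi> \<in> contractive_characters B N" for \<psi>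
    using ts character_product_bounded_bilinear[OF phi that] by (simp add: tensor_sums_def)
  have vanish: "\<rho> f (\<lambda>a b. \<phi> a * \<psi> b) = 0"
    if psi: "\<psi> \<in> contractive_characters B N" and h: "h \<in> B" and ne: "\<phi> h \<noteq> \<psi> h" for \<psi> h
  proof -
    define T where "T g = \<rho> g (\<lambda>a b. \<phi> a * \<psi> b)" for g
    have T_left: "T (g * k) = \<phi> g * T k" if "g \<in> B" "k \<in> B" for g k
      using tensor_scaled_character_product[OF phi psi tensor[OF that(2)], of "\<phi> g"]
        character_product_bounded_bilinear[OF phi psi]
      by (simp add: T_def left[OF that] tensor_left_def contractive_charactersD(3)[OF phi] mult.assoc)
    have T_right: "T (g * k) = \<psi> k * T g" if "g \<in> B" "k \<in> B" for g k
      using tensor_scaled_character_product[OF phi psi tensor[OF that(1)], of "\<psi> k"]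
        character_product_bounded_bilinear[OF phi psi]
      by (simp add: T_def right[OF that] tensor_right_def contractive_charactersD(3)[OF psi] ac_simps)
    \<comment> \<open>Comparing the two actions at \<open>h * h\<close> kills \<open>T h\<close>; then \<open>f * h\<close> and \<open>h * f\<close> kill \<open>T f\<close>,
      since \<open>\<phi> h\<close> and \<open>\<psi> h\<close> are not both zero.\<close>
    have "T h = 0"
      using T_left[OF h h] T_right[OF h h] ne by auto
    then have "\<psi> h * T f = 0" "\<phi> h * T f = 0"
      using T_left[OF f h] T_right[OF f h] T_left[OF h f] T_right[OF h f] by auto
    then show ?thesis using ne by (auto simp: T_def)
  qed
  show thesis
    using ts that[of a b] series vanish character_of_diagonal_op[OF phi closed diag[OF f]] phi
    by (simp add: tensor_sums_def)
qed

text \<open>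
  The index set \<open>S\<close> stands for a continuous injection into the character space of \<open>B\<close>, so that the
  result applies both to points of \<open>X\<close> and to characters of \<open>A\<close>.
\<close>
lemma biprojective_imp_discrete:
  fixes \<eta> :: "'p::topological_space \<Rightarrow> 'b::complex_algebra \<Rightarrow> complex"
  assumes bip: "biprojective B N"
    and closed: "\<And>f g. f \<in> B \<Longrightarrow> g \<in> B \<Longrightarrow> f + g \<in> B" "\<And>f g. f \<in> B \<Longrightarrow> g \<in> B \<Longrightarrow> f - g \<in> B"
      "\<And>f g. f \<in> B \<Longrightarrow> g \<in> B \<Longrightarrow> f * g \<in> B"
    and char: "\<And>p. p \<in> S \<Longrightarrow> \<eta> p \<in> contractive_characters B N"
    and nonzero: "\<And>p. p \<in> S \<Longrightarrow> \<exists>f\<in>B. \<eta> p f \<noteq> 0"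
    and sep: "\<And>p q. p \<in> S \<Longrightarrow> q \<in> S \<Longrightarrow> p \<noteq> q \<Longrightarrow> \<exists>f\<in>B. \<eta> p f \<noteq> \<eta> q f"
    and cont: "\<And>f. f \<in> B \<Longrightarrow> continuous_on S (\<lambda>p. \<eta> p f)"
  shows "discrete S"
proof (rule discreteI)
  fix p assume p: "p \<in> S"
  obtain f where f: "f \<in> B" "\<eta> p f \<noteq> 0" using nonzero[OF p] by blast
  obtain a b where ab: "range a \<subseteq> B" "range b \<subseteq> B" "summable (\<lambda>n. N (a n) * N (b n))"
    and at_p: "(\<Sum>n. \<eta> p (a n) * \<eta> p (b n)) = \<eta> p f"
    and off_p: "\<And>\<psi> h. \<psi> \<in> contractive_characters B N \<Longrightarrow> h \<in> B \<Longrightarrow> \<eta> p h \<noteq> \<psi> h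
      \<Longrightarrow> (\<Sum>n. \<eta> p (a n) * \<psi> (b n)) = 0"
    by (rule biprojective_separating_series[OF bip closed char[OF p] f(1)]) (blast+)
  define H where "H q = (\<Sum>n. \<eta> p (a n) * \<eta> q (b n))" for q
  have mem: "a n \<in> B" "b n \<in> B" for n using ab by auto
  have "uniform_limit S (\<lambda>n q. \<Sum>i<n. \<eta> p (a i) * \<eta> q (b i)) H sequentially"
    unfolding H_def
    by (rule Weierstrass_m_test[OF _ ab(3)])
      (auto intro!: contractive_character_product_le char p mem)
  then have "continuous_on S H"
    by (rule uniform_limit_theorem[rotated])
      (auto intro!: always_eventually continuous_intros cont mem)
  then obtain U where "open U" "U \<inter> S = H -` (- {0}) \<inter> S"
    using open_Compl[OF closed_singleton[of "0::complex"]]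
    unfolding continuous_on_open_invariant by blast
  moreover have "H q = 0" if "q \<in> S" "q \<noteq> p" for q
    using sep[OF p that(1)] that off_p[OF char[OF that(1)]] unfolding H_def by blast
  then have "H -` (- {0}) \<inter> S = {p}"
    using p f(2) at_p by (auto simp: H_def)
  ultimately show "p isolated_in S"
    using p unfolding isolated_in_def by auto
qed

section \<open>Algebras of vector-valued functions\<close>

lemma evaluation_contractive_character:
  assumes "\<phi> \<in> characters" and "\<And>f. f \<in> F \<Longrightarrow> norm (f x) \<le> N f"
  shows "(\<lambda>f. \<phi> (f x)) \<in> contractive_characters F N"
  using assms(1) order_trans[OF character_norm_le[OF assms(1)] assms(2)]
  by (simp add: contractive_characters_def characters_def scaleC_fun_def)

text \<open>
  Applied to the characters \<open>f \<mapsto> \<phi> (f x)\<close> with \<open>x\<close> fixed: the hypothesis \<open>onto\<close> says that evaluation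
  at \<open>x\<close> loses nothing of \<open>A\<close>.
\<close>
lemma function_algebra_discrete_characters:
  fixes F :: "('x \<Rightarrow> 'a::complex_banach_algebra) set"
  assumes bip: "biprojective F N"
    and closed: "\<And>f g. f \<in> F \<Longrightarrow> g \<in> F \<Longrightarrow> f + g \<in> F" "\<And>f g. f \<in> F \<Longrightarrow> g \<in> F \<Longrightarrow> f - g \<in> F"
      "\<And>f g. f \<in> F \<Longrightarrow> g \<in> F \<Longrightarrow> f * g \<in> F"
    and bound: "\<And>f x. f \<in> F \<Longrightarrow> norm (f x) \<le> N f"
    and onto: "\<And>a. \<exists>f\<in>F. f x = a"
  shows "discrete (characters :: ('a \<Rightarrow> complex) set)"
proof (rule biprojective_imp_discrete[OF bip closed, where \<eta> = "\<lambda>\<phi> f. \<phi> (f x)"])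
  show "(\<lambda>f. \<phi> (f x)) \<in> contractive_characters F N" if "\<phi> \<in> characters" for \<phi>
    using evaluation_contractive_character[OF that bound] .
  show "\<exists>f\<in>F. \<phi> (f x) \<noteq> 0" if phi: "\<phi> \<in> characters" for \<phi>
  proof -
    obtain a where "\<phi> a \<noteq> 0" using phi by (auto simp: characters_def)
    then show ?thesis using onto[of a] by blast
  qed
  show "\<exists>f\<in>F. \<phi> (f x) \<noteq> \<psi> (f x)" if ne: "\<phi> \<noteq> \<psi>" for \<phi> \<psi>
  proof -
    obtain a where "\<phi> a \<noteq> \<psi> a" using ne by (auto simp: fun_eq_iff)
    then show ?thesis using onto[of a] by blast
  qed
  show "continuous_on characters (\<lambda>\<phi>. \<phi> (f x))" for f :: "'x \<Rightarrow> 'a"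
    by (rule continuous_on_subset[OF continuous_on_product_coordinates]) simp
qed auto

text \<open>
  Applied to the characters \<open>f \<mapsto> \<phi> (f x)\<close> with \<open>\<phi>\<close> fixed. Separating functions are taken of the
  form \<open>z \<mapsto> h z *\<^sub>R a\<close> because \<open>\<phi>\<close> could fail to distinguish two arbitrary values in \<open>A\<close>, whereas it
  distinguishes different multiples of an element \<open>a\<close> with \<open>\<phi> a \<noteq> 0\<close>.
\<close>
lemma function_algebra_discrete_points:
  fixes F :: "('x::topological_space \<Rightarrow> 'a::complex_banach_algebra) set"
  assumes bip: "biprojective F N"
    and closed: "\<And>f g. f \<in> F \<Longrightarrow> g \<in> F \<Longrightarrow> f + g \<in> F" "\<And>f g. f \<in> F \<Longrightarrow> g \<in> F \<Longrightarrow> f - g \<in> F"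
      "\<And>f g. f \<in> F \<Longrightarrow> g \<in> F \<Longrightarrow> f * g \<in> F"
    and bound: "\<And>f x. f \<in> F \<Longrightarrow> norm (f x) \<le> N f"
    and onto: "\<And>x a. \<exists>f\<in>F. f x = a"
    and nonempty: "characters \<noteq> ({} :: ('a \<Rightarrow> complex) set)"
    and cont: "\<And>f. f \<in> F \<Longrightarrow> continuous_on UNIV f"
    and sep: "\<And>x y. x \<noteq> y \<Longrightarrow> \<exists>h::'x \<Rightarrow> real. h x \<noteq> h y \<and> (\<forall>a. (\<lambda>z. h z *\<^sub>R a) \<in> F)"
  shows "discrete (UNIV :: 'x set)"
proof -
  obtain \<phi> :: "'a \<Rightarrow> complex" where phi: "\<phi> \<in> characters" using nonempty by blast
  then obtain a where a: "\<phi> a \<noteq> 0" by (auto simp: characters_def)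
  have phi_diff: "\<phi> (u - v) = \<phi> u - \<phi> v" for u v
  proof -
    have "\<phi> (u - v + v) = \<phi> (u - v) + \<phi> v"
      using phi unfolding characters_def by blast
    then show ?thesis by simp
  qed
  have phi_cont: "continuous_on UNIV \<phi>"
  proof (rule continuous_onI)
    fix x :: 'a and e :: real assume "e > 0"
    moreover have "dist (\<phi> x') (\<phi> x) \<le> dist x' x" for x'
      using character_norm_le[OF phi, of "x' - x"] by (simp add: dist_norm phi_diff)
    ultimately show "\<exists>d>0. \<forall>x'\<in>UNIV. dist x' x < d \<longrightarrow> dist (\<phi> x') (\<phi> x) \<le> e"
      by (meson less_imp_le order_trans)
  qed
  show ?thesis
  proof (rule biprojective_imp_discrete[OF bip closed, where \<eta> = "\<lambda>x f. \<phi> (f x)"])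
    show "(\<lambda>f. \<phi> (f x)) \<in> contractive_characters F N" for x
      using evaluation_contractive_character[OF phi bound] .
    show "\<exists>f\<in>F. \<phi> (f x) \<noteq> 0" for x
      using onto[of x a] a by blast
    show "\<exists>f\<in>F. \<phi> (f x) \<noteq> \<phi> (f y)" if xy: "x \<noteq> y" for x y
    proof -
      obtain h :: "'x \<Rightarrow> real" where h: "h x \<noteq> h y" "(\<lambda>z. h z *\<^sub>R a) \<in> F"
        using sep[OF xy] by blast
      have "\<phi> (h x *\<^sub>R a) \<noteq> \<phi> (h y *\<^sub>R a)"
        using h(1) a by (simp add: character_scaleR[OF phi])
      then show ?thesis using h(2) by (intro bexI[of _ "\<lambda>z. h z *\<^sub>R a"]) auto
    qed
    show "continuous_on UNIV (\<lambda>x. \<phi> (f x))" if "f \<in> F" for f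
      using continuous_on_compose2[OF phi_cont cont[OF that]] by simp
  qed auto
qed

section \<open>Continuous functions on locally compact spaces\<close>

lemma norm_le_sup_norm:
  assumes "bounded (range f)"
  shows "norm (f x) \<le> sup_norm f"
proof -
  have "bdd_above (range (\<lambda>x. norm (f x)))"
    using assms by (auto simp: bounded_iff bdd_above_def)
  then show ?thesis unfolding sup_norm_def by (rule cSUP_upper2) auto
qed

lemma bounded_range_algebra:
  fixes f g :: "'x \<Rightarrow> 'a::complex_banach_algebra"
  assumes "bounded (range f)" "bounded (range g)"
  shows "bounded (range (f + g))" "bounded (range (f - g))" "bounded (range (f * g))"
proof -
  obtain K L where K: "\<And>x. norm (f x) \<le> K" and L: "\<And>x. norm (g x) \<le> L"
    using assms by (auto simp: bounded_iff)
  have "norm ((f + g) x) \<le> K + L" "norm ((f - g) x) \<le> K + L" for x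
    using K[of x] L[of x] norm_triangle_ineq[of "f x" "g x"] norm_triangle_ineq4[of "f x" "g x"]
    by auto
  moreover have "norm ((f * g) x) \<le> K * L" for x
    using norm_mult_ineq[of "f x" "g x"] mult_mono[OF K[of x] L[of x]] order_trans[OF norm_ge_zero K[of x]]
    by simp
  ultimately show "bounded (range (f + g))" "bounded (range (f - g))" "bounded (range (f * g))"
    by (auto simp: bounded_iff)
qed

lemma Cb_closed:
  assumes "f \<in> Cb" "g \<in> Cb"
  shows "f + g \<in> Cb" "f - g \<in> Cb" "f * g \<in> Cb"
  using assms bounded_range_algebra[of f g]
  by (auto simp: Cb_def plus_fun_def fun_diff_def times_fun_def intro!: continuous_intros)

lemma C0_subset_Cb:
  "(C0 :: ('x::topological_space \<Rightarrow> 'a::complex_banach_algebra) set) \<subseteq> Cb"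
proof
  fix f :: "'x \<Rightarrow> 'a" assume f: "f \<in> C0"
  then have cont: "continuous_on UNIV f" by (simp add: C0_def)
  obtain K where K: "compact K" "\<And>x. x \<notin> K \<Longrightarrow> norm (f x) < 1"
    using f unfolding C0_def by (auto dest!: spec[of _ 1])
  have "bounded (f ` K)"
    using K(1) cont by (meson compact_continuous_image compact_imp_bounded continuous_on_subset subset_UNIV)
  then obtain L where "\<And>x. x \<in> K \<Longrightarrow> norm (f x) \<le> L" by (auto simp: bounded_iff)
  then have "norm (f x) \<le> max 1 L" for x
    using K(2)[of x] by (cases "x \<in> K") (auto simp: le_max_iff_disj less_imp_le)
  then show "f \<in> Cb" using cont by (auto simp: Cb_def bounded_iff)
qed

lemma C0_memI:
  assumes "continuous_on UNIV h"
    and "f \<in> C0" "g \<in> C0" "0 \<le> C" "0 \<le> D"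
    and le: "\<And>x. norm (h x) \<le> C * norm (f x) + D * norm (g x)"
  shows "h \<in> C0"
  unfolding C0_def
proof (clarsimp simp: assms(1))
  fix e :: real assume "e > 0"
  define d where "d = e / (C + D + 1)"
  have d: "d > 0" "(C + D) * d < e"
    using \<open>e > 0\<close> assms(4,5) by (auto simp: d_def field_simps)
  obtain K where K: "compact K" "\<And>x. x \<notin> K \<Longrightarrow> norm (f x) < d"
    using assms(2) d(1) unfolding C0_def by blast
  obtain L where L: "compact L" "\<And>x. x \<notin> L \<Longrightarrow> norm (g x) < d"
    using assms(3) d(1) unfolding C0_def by blast
  have "norm (h x) < e" if "x \<notin> K \<union> L" for x
  proof -
    have "C * norm (f x) + D * norm (g x) \<le> C * d + D * d"
      using K(2) L(2) that assms(4,5) by (intro add_mono mult_left_mono) (auto simp: less_imp_le)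
    also have "\<dots> < e" using d(2) by (simp add: distrib_right)
    finally show ?thesis using le[of x] by simp
  qed
  then show "\<exists>K. compact K \<and> (\<forall>x. x \<notin> K \<longrightarrow> norm (h x) < e)"
    using compact_Un[OF K(1) L(1)] by blast
qed

lemma C0_closed:
  assumes f: "f \<in> C0" and g: "g \<in> C0"
  shows "f + g \<in> C0" "f - g \<in> C0" "f * g \<in> C0"
proof -
  have cont: "continuous_on UNIV f" "continuous_on UNIV g" using f g by (auto simp: C0_def)
  have "continuous_on UNIV (f + g)" "continuous_on UNIV (f - g)" "continuous_on UNIV (f * g)"
    using cont by (simp_all add: plus_fun_def fun_diff_def times_fun_def continuous_intros)
  note cont = this
  show "f + g \<in> C0"
    by (rule C0_memI[OF cont(1) f g, of 1 1]) (simp_all add: norm_triangle_ineq)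
  show "f - g \<in> C0"
    by (rule C0_memI[OF cont(2) f g, of 1 1]) (simp_all add: norm_triangle_ineq4)
  obtain K where K: "\<And>x. norm (f x) \<le> K"
    using f C0_subset_Cb by (auto simp: Cb_def bounded_iff)
  show "f * g \<in> C0"
  proof (rule C0_memI[OF cont(3) f g, of 0 K])
    show "0 \<le> K" using order_trans[OF norm_ge_zero K] .
    show "norm ((f * g) x) \<le> 0 * norm (f x) + K * norm (g x)" for x
      using norm_mult_ineq[of "f x" "g x"] mult_right_mono[OF K[of x], of "norm (g x)"] by simp
  qed simp
qed

text \<open>
  Complete regularity yields a bump function; requiring it to vanish off a compact neighbourhood
  \<open>K\<close> of \<open>x\<close> gives compact support.
\<close>
lemma locally_compact_bump:
  fixes x y :: "'x::t2_space"
  assumes lc: "locally_compact_space (euclidean :: 'x topology)" and ne: "x \<noteq> y"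
  shows "\<exists>(h :: 'x \<Rightarrow> real) K. continuous_on UNIV h \<and> h x = 1 \<and> h y = 0 \<and> compact K \<and>
    (\<forall>z. z \<notin> K \<longrightarrow> h z = 0)"
proof -
  have "\<exists>U V. open U \<and> open V \<and> u \<in> U \<and> v \<in> V \<and> disjnt U V" if "u \<noteq> v" for u v :: 'x
    using hausdorff[OF that] by (auto simp: disjnt_def)
  then have "Hausdorff_space (euclidean :: 'x topology)"
    by (simp add: Hausdorff_space_def)
  then have reg: "completely_regular_space (euclidean :: 'x topology)"
    using lc locally_compact_regular_imp_completely_regular_space by blast
  have "\<exists>U K. open U \<and> compact K \<and> x \<in> U \<and> U \<subseteq> K"
    using lc by (simp add: locally_compact_space_def)
  then obtain U K where U: "open U" "compact K" "x \<in> U" "U \<subseteq> K" by blast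
  \<comment> \<open>Removing \<open>y\<close> from the neighbourhood makes the bump vanish there as well.\<close>
  have "open (U - {y})" "x \<in> U - {y}" using U ne by auto
  then have "\<exists>f :: 'x \<Rightarrow> real. continuous_map euclidean euclidean f \<and> f x = 0 \<and>
      f ` (topspace euclidean - (U - {y})) \<subseteq> {1}"
    using reg[unfolded completely_regular_space_alt', rule_format, of "U - {y}" x] by simp
  then obtain f :: "'x \<Rightarrow> real" where f: "continuous_on UNIV f" "f x = 0"
      "f ` (UNIV - (U - {y})) \<subseteq> {1}"
    by auto
  have cont: "continuous_on UNIV (\<lambda>z. 1 - f z)"
    using f(1) by (intro continuous_intros)
  have "f y = 1" using f(3) by blast
  moreover have "f z = 1" if "z \<notin> K" for z
    using f(3) U(4) that by blast
  ultimately show ?thesis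
    using cont f(2) U(2) by (intro exI[of _ "\<lambda>z. 1 - f z"] exI[of _ K]) simp
qed

lemma bump_in_C0:
  fixes h :: "'x::topological_space \<Rightarrow> real" and a :: "'a::complex_banach_algebra"
  assumes "continuous_on UNIV h" "compact K" "\<forall>z. z \<notin> K \<longrightarrow> h z = 0"
  shows "(\<lambda>z. h z *\<^sub>R a) \<in> C0"
  using assms by (auto simp: C0_def intro!: continuous_intros exI[of _ K])

lemma bump_separation:
  fixes x y :: "'x::t2_space"
  assumes "locally_compact_space (euclidean :: 'x topology)" "x \<noteq> y"
  shows "\<exists>h :: 'x \<Rightarrow> real. h x \<noteq> h y \<and> (\<forall>a :: 'a::complex_banach_algebra. (\<lambda>z. h z *\<^sub>R a) \<in> C0)"
proof -
  obtain h :: "'x \<Rightarrow> real" and K where h: "continuous_on UNIV h" "h x = 1" "h y = 0" "compact K"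
      "\<forall>z. z \<notin> K \<longrightarrow> h z = 0"
    using locally_compact_bump[OF assms] by blast
  then show ?thesis
    using bump_in_C0[OF h(1,4,5)] by (intro exI[of _ h]) auto
qed

text \<open>A one-point space needs separate treatment, as no second point is there to be separated from.\<close>
lemma C0_onto:
  fixes x :: "'x::t2_space" and a :: "'a::complex_banach_algebra"
  assumes "locally_compact_space (euclidean :: 'x topology)"
  shows "\<exists>f\<in>C0. f x = a"
proof (cases "\<exists>y. x \<noteq> y")
  case True
  then obtain y where ne: "x \<noteq> y" by blast
  obtain h :: "'x \<Rightarrow> real" and K where "continuous_on UNIV h" "h x = 1" "compact K"
      "\<forall>z. z \<notin> K \<longrightarrow> h z = 0"
    using locally_compact_bump[OF assms ne] by blast
  then show ?thesis
    by (intro bexI[OF _ bump_in_C0[of h K a]]) simp_all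
next
  case False
  then have "z \<in> {x}" for z by (metis singletonI)
  then have "(UNIV :: 'x set) = {x}" by (rule UNIV_eq_I)
  then have "compact (UNIV :: 'x set)" using compact_sing[of x] by simp
  then have "(\<lambda>_ :: 'x. a) \<in> C0"
    unfolding C0_def by (auto intro!: exI[of _ "UNIV :: 'x set"])
  then show ?thesis by (rule bexI[rotated]) simp
qed

lemma Cb_onto: "\<exists>f\<in>Cb. f x = a"
  by (rule bexI[of _ "\<lambda>_. a"]) (simp_all add: Cb_def)

section \<open>Lipschitz functions\<close>

lemma lip_quot_nonneg: "0 \<le> lip_quot \<alpha> f p"
  by (simp add: lip_quot_def split: prod.split)

lemma lip_quot_le_iff:
  assumes "\<alpha> > 0"
  shows "lip_quot \<alpha> f (x, y) \<le> L \<longleftrightarrow> (if x = y then 0 \<le> L else norm (f x - f y) \<le> L * dist x y powr \<alpha>)"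
  by (simp add: lip_quot_def field_simps)

lemma norm_le_lip_norm:
  assumes "f \<in> Lip \<alpha>"
  shows "norm (f x) \<le> lip_norm \<alpha> f"
proof -
  have bdd: "bounded (range f)" "bdd_above (range (lip_quot \<alpha> f))"
    using assms by (auto simp: Lip_def)
  have "0 \<le> (SUP p. lip_quot \<alpha> f p)"
    using cSUP_upper2[OF bdd(2) UNIV_I] lip_quot_nonneg by blast
  then show ?thesis
    using norm_le_sup_norm[OF bdd(1), of x] by (simp add: lip_norm_def)
qed

lemma Lip_continuous:
  fixes f :: "'m::metric_space \<Rightarrow> 'a::complex_banach_algebra"
  assumes "f \<in> Lip \<alpha>" "\<alpha> > 0"
  shows "continuous_on UNIV f"
proof -
  obtain L where L: "\<And>p. lip_quot \<alpha> f p \<le> L"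
    using assms(1) by (auto simp: Lip_def bdd_above_def)
  have le: "norm (f x - f y) \<le> L * dist x y powr \<alpha>" for x y
    using L[of "(x, y)"] assms(2) by (cases "x = y") (auto simp: lip_quot_le_iff)
  have "(f \<longlongrightarrow> f x) (at x)" for x
  proof -
    have "((\<lambda>y. dist y x powr \<alpha>) \<longlongrightarrow> 0) (at x)"
      using assms(2) tendsto_dist[OF tendsto_ident_at tendsto_const[of x], of x UNIV]
      by (intro tendsto_zero_powrI[where b = \<alpha>]) auto
    then have "((\<lambda>y. L * dist y x powr \<alpha>) \<longlongrightarrow> 0) (at x)"
      by (rule tendsto_mult_right_zero)
    then have "((\<lambda>y. f y - f x) \<longlongrightarrow> 0) (at x)"
      by (rule Lim_null_comparison[rotated]) (auto intro!: always_eventually le)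
    then show ?thesis by (rule LIM_zero_cancel)
  qed
  then show ?thesis by (simp add: continuous_on_def)
qed

text \<open>
  A bounded function whose difference quotients are dominated by those of members is a member.
  Closure under the ring operations and the membership of \<open>z \<mapsto> norm (f z - f x) *\<^sub>R a\<close> reduce to this.
\<close>
lemma Lip_memI:
  assumes "bounded (range h)" "f \<in> Lip \<alpha>" "g \<in> Lip \<alpha>" "0 \<le> C" "0 \<le> D"
    and le: "\<And>p. lip_quot \<alpha> h p \<le> C * lip_quot \<alpha> f p + D * lip_quot \<alpha> g p"
  shows "h \<in> Lip \<alpha>"
proof -
  obtain L M where LM: "\<And>p. lip_quot \<alpha> f p \<le> L" "\<And>p. lip_quot \<alpha> g p \<le> M"
    using assms(2,3) by (auto simp: Lip_def bdd_above_def)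
  have "lip_quot \<alpha> h p \<le> C * L + D * M" for p
    using le[of p] mult_left_mono[OF LM(1)[of p] assms(4)] mult_left_mono[OF LM(2)[of p] assms(5)]
    by linarith
  then show ?thesis
    using assms(1) by (auto simp: Lip_def bdd_above_def)
qed

lemma little_lip_memI:
  fixes h :: "'m::metric_space \<Rightarrow> 'a::complex_banach_algebra"
  assumes "bounded (range h)" "f \<in> little_lip \<alpha>" "g \<in> little_lip \<alpha>" "0 \<le> C" "0 \<le> D"
    and le: "\<And>p. lip_quot \<alpha> h p \<le> C * lip_quot \<alpha> f p + D * lip_quot \<alpha> g p"
  shows "h \<in> little_lip \<alpha>"
proof -
  have "h \<in> Lip \<alpha>"
    using assms Lip_memI[of h f \<alpha> g C D] by (auto simp: little_lip_def)
  moreover have "\<exists>\<delta>>0. \<forall>x y. dist x y < \<delta> \<longrightarrow> lip_quot \<alpha> h (x, y) < e" if "e > 0" for e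
  proof -
    define d where "d = e / (C + D + 1)"
    have d: "d > 0" "(C + D) * d < e"
      using \<open>e > 0\<close> assms(4,5) by (auto simp: d_def field_simps)
    obtain r where r: "r > 0" "\<And>x y. dist x y < r \<Longrightarrow> lip_quot \<alpha> f (x, y) < d"
      using assms(2) d(1) unfolding little_lip_def by blast
    obtain s where s: "s > 0" "\<And>x y. dist x y < s \<Longrightarrow> lip_quot \<alpha> g (x, y) < d"
      using assms(3) d(1) unfolding little_lip_def by blast
    have "lip_quot \<alpha> h (x, y) < e" if "dist x y < min r s" for x y
    proof -
      have "C * lip_quot \<alpha> f (x, y) + D * lip_quot \<alpha> g (x, y) \<le> C * d + D * d"
        using r(2)[of x y] s(2)[of x y] that assms(4,5)
        by (intro add_mono mult_left_mono) (auto simp: less_imp_le)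
      also have "\<dots> < e" using d(2) by (simp add: distrib_right)
      finally show ?thesis using le[of "(x, y)"] by simp
    qed
    then show ?thesis using r(1) s(1) by (intro exI[of _ "min r s"]) auto
  qed
  ultimately show ?thesis by (simp add: little_lip_def)
qed

lemma lip_quot_add: "lip_quot \<alpha> (f + g) p \<le> 1 * lip_quot \<alpha> f p + 1 * lip_quot \<alpha> g p"
proof (cases p)
  case (Pair x y)
  have "norm ((f + g) x - (f + g) y) \<le> norm (f x - f y) + norm (g x - g y)"
    using norm_triangle_ineq[of "f x - f y" "g x - g y"] by (simp add: algebra_simps)
  then show ?thesis
    by (simp add: Pair lip_quot_def divide_right_mono flip: add_divide_distrib)
qed

lemma lip_quot_diff: "lip_quot \<alpha> (f - g) p \<le> 1 * lip_quot \<alpha> f p + 1 * lip_quot \<alpha> g p"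
proof (cases p)
  case (Pair x y)
  have "norm ((f - g) x - (f - g) y) \<le> norm (f x - f y) + norm (g x - g y)"
    using norm_triangle_ineq4[of "f x - f y" "g x - g y"] by (simp add: algebra_simps)
  then show ?thesis
    by (simp add: Pair lip_quot_def divide_right_mono flip: add_divide_distrib)
qed

lemma lip_quot_mult:
  fixes f g :: "'m::metric_space \<Rightarrow> 'a::complex_banach_algebra"
  assumes K: "\<And>x. norm (f x) \<le> K" and L: "\<And>x. norm (g x) \<le> L"
  shows "lip_quot \<alpha> (f * g) p \<le> L * lip_quot \<alpha> f p + K * lip_quot \<alpha> g p"
proof (cases p)
  case (Pair x y)
  have "(f * g) x - (f * g) y = (f x - f y) * g x + f y * (g x - g y)"
    by (simp add: algebra_simps)
  also have "norm \<dots> \<le> norm (f x - f y) * norm (g x) + norm (f y) * norm (g x - g y)"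
    by (intro order_trans[OF norm_triangle_ineq] add_mono norm_mult_ineq)
  also have "\<dots> \<le> L * norm (f x - f y) + K * norm (g x - g y)"
    using mult_left_mono[OF L[of x], of "norm (f x - f y)"]
      mult_right_mono[OF K[of y], of "norm (g x - g y)"] by (simp add: mult.commute)
  finally show ?thesis
    by (simp add: Pair lip_quot_def divide_right_mono flip: add_divide_distrib)
qed

lemma Lip_bounded:
  assumes "f \<in> Lip \<alpha>"
  obtains K where "0 \<le> K" "\<And>x. norm (f x) \<le> K"
proof -
  obtain K where "\<And>x. norm (f x) \<le> K"
    using assms by (auto simp: Lip_def bounded_iff)
  then show thesis using that[of K] order_trans[OF norm_ge_zero] by blast
qed

lemma Lip_closed:
  assumes f: "f \<in> Lip \<alpha>" and g: "g \<in> Lip \<alpha>"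
  shows "f + g \<in> Lip \<alpha>" "f - g \<in> Lip \<alpha>" "f * g \<in> Lip \<alpha>"
proof -
  have bounded: "bounded (range f)" "bounded (range g)" using f g by (auto simp: Lip_def)
  note bounded = bounded_range_algebra[OF bounded]
  show "f + g \<in> Lip \<alpha>" by (rule Lip_memI[OF bounded(1) f g _ _ lip_quot_add]) auto
  show "f - g \<in> Lip \<alpha>" by (rule Lip_memI[OF bounded(2) f g _ _ lip_quot_diff]) auto
  obtain K L where KL: "0 \<le> K" "\<And>x. norm (f x) \<le> K" "0 \<le> L" "\<And>x. norm (g x) \<le> L"
    using Lip_bounded[OF f] Lip_bounded[OF g] by metis
  show "f * g \<in> Lip \<alpha>"
    by (rule Lip_memI[OF bounded(3) f g KL(3,1) lip_quot_mult[OF KL(2,4)]])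
qed

lemma little_lip_closed:
  assumes f: "f \<in> little_lip \<alpha>" and g: "g \<in> little_lip \<alpha>"
  shows "f + g \<in> little_lip \<alpha>" "f - g \<in> little_lip \<alpha>" "f * g \<in> little_lip \<alpha>"
proof -
  have Lip: "f \<in> Lip \<alpha>" "g \<in> Lip \<alpha>" using f g by (auto simp: little_lip_def)
  then have bounded: "bounded (range f)" "bounded (range g)" by (auto simp: Lip_def)
  note bounded = bounded_range_algebra[OF bounded]
  show "f + g \<in> little_lip \<alpha>" by (rule little_lip_memI[OF bounded(1) f g _ _ lip_quot_add]) auto
  show "f - g \<in> little_lip \<alpha>" by (rule little_lip_memI[OF bounded(2) f g _ _ lip_quot_diff]) auto
  obtain K L where KL: "0 \<le> K" "\<And>x. norm (f x) \<le> K" "0 \<le> L" "\<And>x. norm (g x) \<le> L"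
    using Lip_bounded[OF Lip(1)] Lip_bounded[OF Lip(2)] by metis
  show "f * g \<in> little_lip \<alpha>"
    by (rule little_lip_memI[OF bounded(3) f g KL(3,1) lip_quot_mult[OF KL(2,4)]])
qed

lemma const_in_little_lip:
  "(\<lambda>_ :: 'm::metric_space. a :: 'a::complex_banach_algebra) \<in> little_lip \<alpha>"
proof -
  have "lip_quot \<alpha> (\<lambda>_ :: 'm. a) p = 0" for p
    by (simp add: lip_quot_def split: prod.split)
  then show ?thesis by (auto simp: little_lip_def Lip_def intro: exI[of _ 1])
qed

lemma Lip_onto: "\<exists>f\<in>Lip \<alpha>. f x = a"
  using const_in_little_lip[of a \<alpha>] by (auto simp: little_lip_def)

lemma little_lip_onto: "\<exists>f\<in>little_lip \<alpha>. f x = a"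
  using const_in_little_lip[of a \<alpha>] by auto

text \<open>
  The reverse triangle inequality: passing to the distance from a fixed value turns an \<open>A\<close>-valued
  separating function into a scalar one without increasing difference quotients.
\<close>
lemma lip_quot_norm_diff:
  fixes f :: "'m::metric_space \<Rightarrow> 'a::complex_banach_algebra"
  shows "lip_quot \<alpha> (\<lambda>z. norm (f z - c) *\<^sub>R (a::'a)) p \<le> norm a * lip_quot \<alpha> f p + 0 * lip_quot \<alpha> f p"
proof (cases p)
  case (Pair x y)
  have "norm (norm (f x - c) *\<^sub>R a - norm (f y - c) *\<^sub>R a) = \<bar>norm (f x - c) - norm (f y - c)\<bar> * norm a"
    by (simp flip: scaleR_left_diff_distrib)
  also have "\<dots> \<le> norm a * norm (f x - f y)"
    using mult_right_mono[OF norm_triangle_ineq3[of "f x - c" "f y - c"], of "norm a"]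
    by (simp add: mult.commute)
  finally show ?thesis
    by (simp add: Pair lip_quot_def divide_right_mono)
qed

lemma bounded_norm_diff:
  fixes f :: "'m::metric_space \<Rightarrow> 'a::complex_banach_algebra" and a :: 'a
  assumes "f \<in> Lip \<alpha>"
  shows "bounded (range (\<lambda>z. norm (f z - c) *\<^sub>R a))"
proof -
  obtain K where K: "\<And>x. norm (f x) \<le> K" using Lip_bounded[OF assms] by blast
  have "norm (norm (f z - c) *\<^sub>R a) \<le> (K + norm c) * norm a" for z
    using K[of z] norm_triangle_ineq4[of "f z" c] by (simp add: mult_right_mono)
  then show ?thesis by (auto simp: bounded_iff)
qed

text \<open>
  With \<open>d = dist u v\<close>, the numerator of the quotient is at most \<open>min 1 d * norm a\<close>. The first
  estimate uses \<open>min 1 d \<le> d powr \<alpha>\<close> and gives the Lipschitz condition; the second uses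
  \<open>d = d powr (1 - \<alpha>) * d powr \<alpha>\<close> and makes small-scale quotients vanish when \<open>\<alpha> < 1\<close>.
\<close>
lemma lip_quot_truncated_dist:
  fixes a :: "'a::complex_banach_algebra" and x u v :: "'m::metric_space"
  assumes "0 < \<alpha>" "\<alpha> \<le> 1"
  defines "f \<equiv> (\<lambda>z. min 1 (dist x z) *\<^sub>R a)"
  shows "lip_quot \<alpha> f (u, v) \<le> norm a" "lip_quot \<alpha> f (u, v) \<le> norm a * dist u v powr (1 - \<alpha>)"
proof -
  define d where "d = dist u v"
  have "norm (f u - f v) = \<bar>min 1 (dist x u) - min 1 (dist x v)\<bar> * norm a"
    by (simp add: f_def flip: scaleR_left_diff_distrib)
  also have "\<bar>min 1 (dist x u) - min 1 (dist x v)\<bar> \<le> min 1 d"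
    using dist_triangle[of x u v] dist_triangle[of x v u] dist_commute[of u v]
      zero_le_dist[of x u] zero_le_dist[of x v]
    unfolding d_def by linarith
  finally have diff: "norm (f u - f v) \<le> min 1 d * norm a"
    by (simp add: mult_right_mono)
  have d0: "0 \<le> d" by (simp add: d_def)
  have "min 1 d \<le> d powr \<alpha>"
  proof (cases "d \<le> 1")
    case True
    then show ?thesis
      using powr_mono'[of \<alpha> 1 d] assms(2) d0 by simp
  next
    case False
    then show ?thesis using ge_one_powr_ge_zero[of d \<alpha>] assms by simp
  qed
  then have "norm (f u - f v) \<le> norm a * d powr \<alpha>"
    using diff mult_right_mono[of "min 1 d" "d powr \<alpha>" "norm a"] by (simp add: mult.commute)
  then show "lip_quot \<alpha> f (u, v) \<le> norm a"
    using assms(1) by (simp add: lip_quot_le_iff d_def)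
  have "d powr (1 - \<alpha>) * d powr \<alpha> = d"
    using d0 by (cases "d = 0") (simp_all flip: powr_add)
  then have "norm (f u - f v) \<le> norm a * d powr (1 - \<alpha>) * d powr \<alpha>"
    using diff mult_right_mono[of "min 1 d" d "norm a"] by (simp add: mult.commute mult.left_commute)
  then show "lip_quot \<alpha> f (u, v) \<le> norm a * dist u v powr (1 - \<alpha>)"
    using assms(1) by (simp add: lip_quot_le_iff d_def)
qed

lemma truncated_dist_in_Lip:
  fixes a :: "'a::complex_banach_algebra" and x :: "'m::metric_space"
  assumes "0 < \<alpha>" "\<alpha> \<le> 1"
  shows "(\<lambda>z. min 1 (dist x z) *\<^sub>R a) \<in> Lip \<alpha>"
proof -
  have "norm (min 1 (dist x z) *\<^sub>R a) \<le> 1 * norm a" for z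
    unfolding norm_scaleR by (rule mult_right_mono) auto
  moreover have "lip_quot \<alpha> (\<lambda>z. min 1 (dist x z) *\<^sub>R a) p \<le> norm a" for p
    by (cases p) (simp add: lip_quot_truncated_dist[OF assms])
  ultimately show ?thesis
    by (auto simp: Lip_def bounded_iff bdd_above_def)
qed

lemma truncated_dist_in_little_lip:
  fixes a :: "'a::complex_banach_algebra" and x :: "'m::metric_space"
  assumes "0 < \<alpha>" "\<alpha> < 1"
  shows "(\<lambda>z. min 1 (dist x z) *\<^sub>R a) \<in> little_lip \<alpha>"
proof -
  let ?f = "\<lambda>z. min 1 (dist x z) *\<^sub>R a"
  have "\<exists>\<delta>>0. \<forall>u v. dist u v < \<delta> \<longrightarrow> lip_quot \<alpha> ?f (u, v) < e" if "e > 0" for e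
  proof -
    define c where "c = e / (norm a + 1)"
    have c: "c > 0" "norm a * c < e"
      using that by (auto simp: c_def field_simps add_pos_nonneg)
    \<comment> \<open>The solution of \<open>\<delta> powr (1 - \<alpha>) = c\<close>.\<close>
    define \<delta> where "\<delta> = c powr (1 / (1 - \<alpha>))"
    have "lip_quot \<alpha> ?f (u, v) < e" if "dist u v < \<delta>" for u v
    proof -
      have "dist u v powr (1 - \<alpha>) \<le> \<delta> powr (1 - \<alpha>)"
        using that assms by (intro powr_mono2) auto
      also have "\<dots> = c"
        using assms c(1) by (simp add: \<delta>_def powr_powr)
      finally have "norm a * dist u v powr (1 - \<alpha>) \<le> norm a * c"
        by (simp add: mult_left_mono)
      then show ?thesis
        using lip_quot_truncated_dist(2)[of \<alpha> x a u v] assms c(2) by simp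
    qed
    moreover have "\<delta> > 0" using c(1) by (simp add: \<delta>_def)
    ultimately show ?thesis by blast
  qed
  then show ?thesis
    using truncated_dist_in_Lip[of \<alpha> x a] assms by (simp add: little_lip_def)
qed

lemma Lip_scalar_separation:
  fixes x y :: "'m::metric_space"
  assumes "0 < \<alpha>" "x \<noteq> y"
    and "\<alpha> \<le> 1 \<or> separates_points (Lip \<alpha> :: ('m \<Rightarrow> 'a::complex_banach_algebra) set)"
  shows "\<exists>h :: 'm \<Rightarrow> real. h x \<noteq> h y \<and> (\<forall>a::'a. (\<lambda>z. h z *\<^sub>R a) \<in> Lip \<alpha>)"
  using assms(3)
proof
  assume "\<alpha> \<le> 1"
  then show ?thesis
    using truncated_dist_in_Lip[OF assms(1)] assms(2)
    by (intro exI[of _ "\<lambda>z. min 1 (dist x z)"]) (auto simp: min_def)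
next
  assume "separates_points (Lip \<alpha> :: ('m \<Rightarrow> 'a) set)"
  then obtain f :: "'m \<Rightarrow> 'a" where f: "f \<in> Lip \<alpha>" "f x \<noteq> f y"
    using assms(2) by (auto simp: separates_points_def)
  have "(\<lambda>z. norm (f z - f x) *\<^sub>R a) \<in> Lip \<alpha>" for a :: 'a
    by (rule Lip_memI[OF bounded_norm_diff[OF f(1)] f(1) f(1) _ _ lip_quot_norm_diff]) auto
  then show ?thesis using f(2) by (intro exI[of _ "\<lambda>z. norm (f z - f x)"]) auto
qed

lemma little_lip_scalar_separation:
  fixes x y :: "'m::metric_space"
  assumes "0 < \<alpha>" "x \<noteq> y"
    and "\<alpha> < 1 \<or> separates_points (little_lip \<alpha> :: ('m \<Rightarrow> 'a::complex_banach_algebra) set)"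
  shows "\<exists>h :: 'm \<Rightarrow> real. h x \<noteq> h y \<and> (\<forall>a::'a. (\<lambda>z. h z *\<^sub>R a) \<in> little_lip \<alpha>)"
  using assms(3)
proof
  assume "\<alpha> < 1"
  then show ?thesis
    using truncated_dist_in_little_lip[OF assms(1)] assms(2)
    by (intro exI[of _ "\<lambda>z. min 1 (dist x z)"]) (auto simp: min_def)
next
  assume "separates_points (little_lip \<alpha> :: ('m \<Rightarrow> 'a) set)"
  then obtain f :: "'m \<Rightarrow> 'a" where f: "f \<in> little_lip \<alpha>" "f x \<noteq> f y"
    using assms(2) by (auto simp: separates_points_def)
  then have "f \<in> Lip \<alpha>" by (simp add: little_lip_def)
  then have "(\<lambda>z. norm (f z - f x) *\<^sub>R a) \<in> little_lip \<alpha>" for a :: 'a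
    by (intro little_lip_memI[OF bounded_norm_diff f(1) f(1) _ _ lip_quot_norm_diff]) auto
  then show ?thesis using f(2) by (intro exI[of _ "\<lambda>z. norm (f z - f x)"]) auto
qed

theorem proposition3p3:
  fixes \<alpha> :: real
  assumes "characters \<noteq> ({} :: ('a::{complex_banach_algebra, comm_ring} \<Rightarrow> complex) set)"
    and "\<alpha> > 0"
  shows
    "(locally_compact_space (euclidean :: 'x::t2_space topology) \<longrightarrow>
        biprojective (Cb :: ('x \<Rightarrow> 'a) set) sup_norm \<longrightarrow>
        discrete (UNIV :: 'x set) \<and> discrete (characters :: ('a \<Rightarrow> complex) set)) \<and>
     (locally_compact_space (euclidean :: 'x topology) \<longrightarrow>
        biprojective (C0 :: ('x \<Rightarrow> 'a) set) sup_norm \<longrightarrow>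
        discrete (UNIV :: 'x set) \<and> discrete (characters :: ('a \<Rightarrow> complex) set)) \<and>
     (biprojective (Lip \<alpha> :: ('m::metric_space \<Rightarrow> 'a) set) (lip_norm \<alpha>) \<longrightarrow>
        (\<alpha> \<le> 1 \<or> separates_points (Lip \<alpha> :: ('m \<Rightarrow> 'a) set) \<longrightarrow> discrete (UNIV :: 'm set)) \<and>
        discrete (characters :: ('a \<Rightarrow> complex) set)) \<and>
     (biprojective (little_lip \<alpha> :: ('m \<Rightarrow> 'a) set) (lip_norm \<alpha>) \<longrightarrow>
        (\<alpha> < 1 \<or> separates_points (little_lip \<alpha> :: ('m \<Rightarrow> 'a) set) \<longrightarrow> discrete (UNIV :: 'm set)) \<and>
        discrete (characters :: ('a \<Rightarrow> complex) set))"
proof -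
  let ?discrete_characters = "discrete (characters :: ('a \<Rightarrow> complex) set)"
  have "discrete (UNIV :: 'x set) \<and> ?discrete_characters"
    if lc: "locally_compact_space (euclidean :: 'x topology)"
      and bip: "biprojective (Cb :: ('x \<Rightarrow> 'a) set) sup_norm"
  proof
    have bound: "norm (f x) \<le> sup_norm f" if "f \<in> Cb" for f :: "'x \<Rightarrow> 'a" and x
      using that by (simp add: Cb_def norm_le_sup_norm)
    have cont: "continuous_on UNIV f" if "f \<in> Cb" for f :: "'x \<Rightarrow> 'a"
      using that by (simp add: Cb_def)
    have sep: "\<exists>h :: 'x \<Rightarrow> real. h x \<noteq> h y \<and> (\<forall>a::'a. (\<lambda>z. h z *\<^sub>R a) \<in> Cb)" if "x \<noteq> y" for x y
      using bump_separation[OF lc that, where ?'a = 'a] C0_subset_Cb by blast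
    show "discrete (UNIV :: 'x set)"
      by (rule function_algebra_discrete_points[OF bip Cb_closed bound Cb_onto assms(1) cont sep])
    show ?discrete_characters
      by (rule function_algebra_discrete_characters[OF bip Cb_closed bound Cb_onto])
  qed
  moreover have "discrete (UNIV :: 'x set) \<and> ?discrete_characters"
    if lc: "locally_compact_space (euclidean :: 'x topology)"
      and bip: "biprojective (C0 :: ('x \<Rightarrow> 'a) set) sup_norm"
  proof
    have bound: "norm (f x) \<le> sup_norm f" if "f \<in> C0" for f :: "'x \<Rightarrow> 'a" and x
      using subsetD[OF C0_subset_Cb that] by (simp add: Cb_def norm_le_sup_norm)
    have cont: "continuous_on UNIV f" if "f \<in> C0" for f :: "'x \<Rightarrow> 'a"
      using that by (simp add: C0_def)
    show "discrete (UNIV :: 'x set)"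
      by (rule function_algebra_discrete_points[OF bip C0_closed bound C0_onto[OF lc] assms(1) cont
            bump_separation[OF lc]])
    show ?discrete_characters
      by (rule function_algebra_discrete_characters[OF bip C0_closed bound C0_onto[OF lc]])
  qed
  moreover have "(\<alpha> \<le> 1 \<or> separates_points (Lip \<alpha> :: ('m \<Rightarrow> 'a) set) \<longrightarrow> discrete (UNIV :: 'm set))
      \<and> ?discrete_characters"
    if bip: "biprojective (Lip \<alpha> :: ('m \<Rightarrow> 'a) set) (lip_norm \<alpha>)"
  proof (intro conjI impI)
    assume sep: "\<alpha> \<le> 1 \<or> separates_points (Lip \<alpha> :: ('m \<Rightarrow> 'a) set)"
    show "discrete (UNIV :: 'm set)"
      by (rule function_algebra_discrete_points[OF bip Lip_closed norm_le_lip_norm Lip_onto assms(1)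
            Lip_continuous[OF _ assms(2)] Lip_scalar_separation[OF assms(2) _ sep]])
  next
    show ?discrete_characters
      by (rule function_algebra_discrete_characters[OF bip Lip_closed norm_le_lip_norm Lip_onto])
  qed
  moreover have "(\<alpha> < 1 \<or> separates_points (little_lip \<alpha> :: ('m \<Rightarrow> 'a) set) \<longrightarrow> discrete (UNIV :: 'm set))
      \<and> ?discrete_characters"
    if bip: "biprojective (little_lip \<alpha> :: ('m \<Rightarrow> 'a) set) (lip_norm \<alpha>)"
  proof (intro conjI impI)
    have Lip: "f \<in> Lip \<alpha>" if "f \<in> little_lip \<alpha>" for f :: "'m \<Rightarrow> 'a"
      using that by (simp add: little_lip_def)
    {
      assume sep: "\<alpha> < 1 \<or> separates_points (little_lip \<alpha> :: ('m \<Rightarrow> 'a) set)"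
      show "discrete (UNIV :: 'm set)"
        by (rule function_algebra_discrete_points[OF bip little_lip_closed norm_le_lip_norm[OF Lip]
              little_lip_onto assms(1) Lip_continuous[OF Lip assms(2)]
              little_lip_scalar_separation[OF assms(2) _ sep]])
    }
    show ?discrete_characters
      by (rule function_algebra_discrete_characters[OF bip little_lip_closed
            norm_le_lip_norm[OF Lip] little_lip_onto])
  qed
  ultimately show ?thesis by blast
qed

end
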